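(* Let $\alpha>0$ and an integer $n\ge 2$ be given, and put $h:=1/(n-1)$. If the function $g:=g_1/g_2:\mathbb{R}_{>0}\to\mathbb{R}_{>0}$ is surjective and decreasing, then the system $$\left\{\begin{array}{rcl} 0&=&-(U_2-U_1)+\frac{h^2}{2}g_1(U_1),\\ 0&=&-(U_{k+1}-2U_k+U_{k-1})+h^2g_1(U_k)\quad(2\le k\le n-1),\\ 0&=&-(U_{n-1}-U_n)+\frac{h^2}{2}g_1(U_n)-h\alpha\, g_2(U_n)\end{array}\right.$$ has a unique positive solution, i.e. a unique solution $(u_1,\ldots,u_n)\in(\mathbb{R}_{>0})^n$.
   Context: $g_1,g_2:\mathbb{R}\to\mathbb{R}$ are functions of class $\mathcal{C}^3(\mathbb{R})$ such that $g_i(0)=0$, $g_i'(x)>0$, $g_i''(x)>0$ and $g_i'''(x)\ge 0$ for all $x>0$ and $i=1,2$. *)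

theory Defs
  imports "HOL-Analysis.Analysis"
begin

definition C_k :: "nat \<Rightarrow> (real \<Rightarrow> real) \<Rightarrow> bool" where
  "C_k k f \<longleftrightarrow>
     (\<forall>j<k. \<forall>x. (deriv ^^ j) f field_differentiable (at x)) \<and>
     continuous_on UNIV ((deriv ^^ k) f)"

definition admissible :: "(real \<Rightarrow> real) \<Rightarrow> bool" where
  "admissible f \<longleftrightarrow>
     C_k 3 f \<and> f 0 = 0 \<and>
     (\<forall>x>0. deriv f x > 0 \<and> (deriv ^^ 2) f x > 0 \<and> (deriv ^^ 3) f x \<ge> 0)"

(* Only the entries U 1, ..., U n occur. For n = 2 the middle family of equations is empty. *)
definition solves_system ::
  "(real \<Rightarrow> real) \<Rightarrow> (real \<Rightarrow> real) \<Rightarrow> real \<Rightarrow> nat \<Rightarrow> (nat \<Rightarrow> real) \<Rightarrow> bool" where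
  "solves_system g1 g2 \<alpha> n U \<longleftrightarrow>
     (let h = 1 / (real n - 1) in
       0 = - (U 2 - U 1) + h\<^sup>2 / 2 * g1 (U 1) \<and>
       (\<forall>k\<in>{2..n-1}. 0 = - (U (k+1) - 2 * U k + U (k-1)) + h\<^sup>2 * g1 (U k)) \<and>
       0 = - (U (n-1) - U n) + h\<^sup>2 / 2 * g1 (U n) - h * \<alpha> * g2 (U n))"

end

theory Submission
  imports Defs
begin

text \<open>
  The first \<open>n - 1\<close> equations determine \<open>U\<^sub>2, \<dots>, U\<^sub>n\<close> from \<open>u = U\<^sub>1\<close> (shooting), so everything
  reduces to the last equation. With \<open>P(u) = U\<^sub>n\<close>, \<open>D(u) = U\<^sub>n - U\<^sub>n\<^sub>-\<^sub>1\<close> and \<open>c = h\<^sup>2\<close>, it says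
  that \<open>A(u) = (D(u)/g\<^sub>1(P(u)) + c/2) \<cdot> g\<^sub>1(P(u))/g\<^sub>2(P(u))\<close> takes the value \<open>h \<alpha>\<close>.

  Uniqueness: \<open>A\<close> is strictly decreasing. As \<open>P\<close> is increasing and \<open>g\<^sub>1/g\<^sub>2\<close> is decreasing, it
  suffices that \<open>D/g\<^sub>1(P)\<close> is strictly decreasing (\<open>inc_over_source_less\<close>). Let \<open>u < v\<close> start the
  trajectories \<open>U\<close> and \<open>V\<close>, with forward increments \<open>d\<^sub>k\<close> and \<open>e\<^sub>k\<close>. By induction
  \<open>e\<^sub>k/d\<^sub>k \<le> g\<^sub>1(V\<^sub>k)/g\<^sub>1(U\<^sub>k)\<close>. For the step put \<open>\<rho> = e\<^sub>k/d\<^sub>k > 1\<close>. Convexity makes \<open>g\<^sub>1\<close> grow over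
  \<open>[V\<^sub>k, V\<^sub>k + \<rho> d\<^sub>k]\<close> by more than \<open>\<rho>\<close> times its growth over \<open>[U\<^sub>k, U\<^sub>k + d\<^sub>k]\<close>, whence
  \<open>g\<^sub>1(V\<^sub>k\<^sub>+\<^sub>1) > \<rho> g\<^sub>1(U\<^sub>k\<^sub>+\<^sub>1)\<close>. The next ratio of increments is the mediant of \<open>\<rho>\<close> and
  \<open>g\<^sub>1(V\<^sub>k\<^sub>+\<^sub>1)/g\<^sub>1(U\<^sub>k\<^sub>+\<^sub>1)\<close>, so it stays below the latter.

  Existence: \<open>D/g\<^sub>1(P)\<close> lies between two constants and \<open>P\<close> takes every positive value, so
  surjectivity of \<open>g\<^sub>1/g\<^sub>2\<close> makes \<open>A\<close> take values on both sides of \<open>h \<alpha>\<close>; the intermediate value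
  theorem applies.
\<close>

section \<open>Source functions\<close>

text \<open>What admissibility contributes: \<open>g\<close> is continuous, vanishes at \<open>0\<close>, and has
  a positive and strictly increasing derivative \<open>g'\<close> on the positive half-line.\<close>

locale convex_source =
  fixes g g' :: "real \<Rightarrow> real"
  assumes cont: "continuous_on UNIV g"
    and zero: "g 0 = 0"
    and deriv: "x > 0 \<Longrightarrow> (g has_real_derivative g' x) (at x)"
    and deriv_pos: "x > 0 \<Longrightarrow> g' x > 0"
    and deriv_less: "0 < x \<Longrightarrow> x < y \<Longrightarrow> g' x < g' y"
begin

lemma strict_mono:
  assumes "0 \<le> x" "x < y"
  shows "g x < g y"
proof (rule DERIV_pos_imp_increasing_open[OF assms(2)])
  show "\<exists>l. (g has_real_derivative l) (at t) \<and> l > 0" if "x < t" for t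
    using deriv[of t] deriv_pos[of t] assms that by auto
  show "continuous_on {x..y} g"
    using cont by (rule continuous_on_subset) simp
qed

lemma mono: "0 \<le> x \<Longrightarrow> x \<le> y \<Longrightarrow> g x \<le> g y"
  using strict_mono[of x y] by (cases "x = y") auto

lemma pos: "x > 0 \<Longrightarrow> g x > 0"
  using strict_mono[of 0 x] zero by simp

lemma stretched_growth:
  assumes x: "0 < x" "x < y" and \<rho>: "1 \<le> \<rho>" and a: "0 < a"
  shows "\<rho> * (g (x + a) - g x) < g (y + \<rho> * a) - g y"
proof -
  let ?\<phi> = "\<lambda>t. g (y + \<rho> * t) - \<rho> * g (x + t)"
  have "?\<phi> 0 < ?\<phi> a"
  proof (rule DERIV_pos_imp_increasing[OF a])
    fix t assume t: "0 \<le> t" "t \<le> a"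
    have le: "t \<le> \<rho> * t"
      using t \<rho> mult_right_mono[of 1 \<rho> t] by simp
    have "(?\<phi> has_real_derivative g' (y + \<rho> * t) * \<rho> - \<rho> * g' (x + t)) (at t)"
      using x t le
      by (auto intro!: derivative_eq_intros DERIV_chain2[of g, OF deriv])
    moreover have "g' (x + t) < g' (y + \<rho> * t)"
      using x t le by (intro deriv_less) auto
    then have "g' (y + \<rho> * t) * \<rho> - \<rho> * g' (x + t) > 0"
      using \<rho> by (simp add: mult.commute)
    ultimately show "\<exists>l. (?\<phi> has_real_derivative l) (at t) \<and> l > 0"
      by blast
  qed
  then show ?thesis
    by (simp add: algebra_simps)
qed

end

lemma convex_source_of_admissible:
  assumes "admissible f"
  shows "convex_source f (deriv f)"
proof -
  have f: "\<forall>j<3. \<forall>x. (deriv ^^ j) f field_differentiable (at x)"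
      "f 0 = 0" "\<And>x. x > 0 \<Longrightarrow> deriv f x > 0" "\<And>x. x > 0 \<Longrightarrow> (deriv ^^ 2) f x > 0"
    using assms unfolding admissible_def C_k_def by blast+
  have d0: "(f has_real_derivative deriv f x) (at x)" for x
    using f(1)[rule_format, of 0 x] by (simp add: DERIV_deriv_iff_field_differentiable)
  have d1: "(deriv f has_real_derivative (deriv ^^ 2) f x) (at x)" for x
    using f(1)[rule_format, of 1 x]
    by (simp add: DERIV_deriv_iff_field_differentiable numeral_2_eq_2)
  show ?thesis
  proof
    show "continuous_on UNIV f"
      using d0 by (intro DERIV_continuous_on) (auto intro: DERIV_subset)
    show "deriv f x < deriv f y" if "0 < x" "x < y" for x y
    proof (rule DERIV_pos_imp_increasing[OF that(2)])
      show "\<exists>l. (deriv f has_real_derivative l) (at t) \<and> l > 0" if "x \<le> t" for t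
        using d1[of t] f(4)[of t] \<open>0 < x\<close> that by auto
    qed
  qed (use f d0 in auto)
qed

section \<open>Shooting\<close>

text \<open>State of the recursion \<open>U\<^sub>k\<^sub>+\<^sub>1 - 2 U\<^sub>k + U\<^sub>k\<^sub>-\<^sub>1 = c g(U\<^sub>k)\<close> started at \<open>u\<close> with the Neumann
  condition of the first equation: the current value and the increment leading to the next value.
  The indices start at \<open>0\<close>, so step \<open>k\<close> carries \<open>(U\<^sub>k\<^sub>+\<^sub>1, U\<^sub>k\<^sub>+\<^sub>2 - U\<^sub>k\<^sub>+\<^sub>1)\<close>.\<close>

primrec shoot :: "(real \<Rightarrow> real) \<Rightarrow> real \<Rightarrow> real \<Rightarrow> nat \<Rightarrow> real \<times> real" where
  "shoot g c u 0 = (u, c / 2 * g u)"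
| "shoot g c u (Suc k) =
    (let x = fst (shoot g c u k) + snd (shoot g c u k) in (x, snd (shoot g c u k) + c * g x))"

text \<open>The value component of the shooting state.\<close>

definition val :: "(real \<Rightarrow> real) \<Rightarrow> real \<Rightarrow> real \<Rightarrow> nat \<Rightarrow> real" where
  "val g c u k = fst (shoot g c u k)"

text \<open>The increment component of the shooting state.\<close>

definition inc :: "(real \<Rightarrow> real) \<Rightarrow> real \<Rightarrow> real \<Rightarrow> nat \<Rightarrow> real" where
  "inc g c u k = snd (shoot g c u k)"

lemma val_0 [simp]: "val g c u 0 = u"
  and inc_0 [simp]: "inc g c u 0 = c / 2 * g u"
  and val_Suc [simp]: "val g c u (Suc k) = val g c u k + inc g c u k"
  and inc_Suc: "inc g c u (Suc k) = inc g c u k + c * g (val g c u (Suc k))"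
  by (simp_all add: val_def inc_def Let_def)

locale shooting = convex_source +
  fixes c :: real
  assumes c_pos: "c > 0"
begin

abbreviation "X \<equiv> val g c"
abbreviation "D \<equiv> inc g c"

lemma continuous_shoot: "continuous_on UNIV (\<lambda>u. X u k) \<and> continuous_on UNIV (\<lambda>u. D u k)"
proof (induction k)
  case 0
  show ?case using cont by (auto intro!: continuous_intros)
next
  case (Suc k)
  then have X: "continuous_on UNIV (\<lambda>u. X u (Suc k))"
    by (auto intro!: continuous_intros)
  then have "continuous_on UNIV (\<lambda>u. g (X u (Suc k)))"
    using continuous_on_compose2[OF cont] by blast
  with X Suc show ?case
    by (auto simp: inc_Suc simp del: val_Suc intro!: continuous_intros)
qed

lemma continuous_on_val: "continuous_on S (\<lambda>u. X u k)"
  and continuous_on_inc: "continuous_on S (\<lambda>u. D u k)"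
  using continuous_shoot[of k] by (simp_all add: continuous_on_subset[OF _ subset_UNIV])

lemma shoot_zero: "X 0 k = 0 \<and> D 0 k = 0"
  by (induction k) (simp_all add: inc_Suc zero)

lemma shoot_pos: "u > 0 \<Longrightarrow> u \<le> X u k \<and> 0 < D u k"
proof (induction k)
  case 0
  then show ?case using c_pos pos by simp
next
  case (Suc k)
  then have "u \<le> X u (Suc k)" by simp
  moreover from this Suc have "0 < c * g (X u (Suc k))"
    using c_pos by (intro mult_pos_pos pos) linarith+
  ultimately show ?case
    using Suc by (simp add: inc_Suc)
qed

lemma val_pos: "u > 0 \<Longrightarrow> X u k > 0"
  using shoot_pos[of u k] by linarith

lemma inc_le: "u > 0 \<Longrightarrow> D u k \<le> c * (real k + 1) * g (X u (Suc k))"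
proof (induction k)
  case 0
  have "g u \<le> g (X u (Suc 0))"
    using 0 shoot_pos[of u 0] by (intro mono) auto
  moreover have "g u > 0" using 0 pos by simp
  ultimately have "c / 2 * g u \<le> c * g (X u (Suc 0))"
    using c_pos by (intro mult_mono) auto
  then show ?case by simp
next
  case (Suc k)
  have "D u (Suc k) \<le> c * (real (Suc k) + 1) * g (X u (Suc k))"
    using Suc by (simp add: inc_Suc algebra_simps)
  also have "\<dots> \<le> c * (real (Suc k) + 1) * g (X u (Suc (Suc k)))"
    using c_pos shoot_pos[OF Suc.prems, of "Suc k"] Suc.prems
    by (intro mult_left_mono mono) auto
  finally show ?case .
qed

text \<open>The inductive step of the comparison of two trajectories: a bound on the ratio of the
  increments by the ratio of the sources persists, strictly, one node further.\<close>

lemma ratio_step: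
  assumes x: "0 < x" "x < y" and d: "0 < d" "d < e"
    and ratio: "e * g x \<le> d * g y"
  shows "e * g (x + d) < d * g (y + e)"
proof -
  let ?\<rho> = "e / d"
  have "?\<rho> * (g (x + d) - g x) < g (y + ?\<rho> * d) - g y"
    using x d by (intro stretched_growth) auto
  then have "e * (g (x + d) - g x) < d * (g (y + e) - g y)"
    using d by (simp add: field_simps)
  with ratio show ?thesis
    by (simp add: algebra_simps)
qed

lemma shoot_compare:
  assumes "0 < u" "u < v"
  shows "X u k < X v k \<and> D u k < D v k \<and> D v k * g (X u k) \<le> D u k * g (X v k)"
proof (induction k)
  case 0
  then show ?case using assms c_pos strict_mono[of u v] by simp
next
  case (Suc k)
  have X: "X u (Suc k) < X v (Suc k)"
    using Suc by simp
  have "g (X u (Suc k)) < g (X v (Suc k))"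
    using X val_pos[OF assms(1), of "Suc k"] by (intro strict_mono) auto
  then have D: "D u (Suc k) < D v (Suc k)"
    using Suc c_pos by (simp add: inc_Suc add_strict_mono)
  have "D v k * g (X u (Suc k)) < D u k * g (X v (Suc k))"
    using Suc ratio_step[of "X u k" "X v k" "D u k" "D v k"] shoot_pos[OF assms(1), of k]
      val_pos[OF assms(1), of k] by simp
  then have "D v (Suc k) * g (X u (Suc k)) \<le> D u (Suc k) * g (X v (Suc k))"
    by (simp add: inc_Suc algebra_simps del: val_Suc)
  with X D show ?case by blast
qed

lemma inc_over_source_less:
  assumes "0 < u" "u < v"
  shows "D v k / g (X v (Suc k)) < D u k / g (X u (Suc k))"
proof -
  have v: "0 < v" using assms by simp
  have "D v k * g (X u (Suc k)) < D u k * g (X v (Suc k))"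
    using shoot_compare[OF assms, of k] ratio_step[of "X u k" "X v k" "D u k" "D v k"]
      shoot_pos[OF assms(1), of k] val_pos[OF assms(1), of k] by simp
  then show ?thesis
    using pos[OF val_pos[OF assms(1)]] pos[OF val_pos[OF v]]
    by (simp add: divide_simps mult.commute del: val_Suc)
qed

lemma val_attains:
  assumes "x > 0"
  obtains u where "u > 0" "X u k = x"
proof -
  have "\<exists>u. 0 \<le> u \<and> u \<le> x \<and> X u k = x"
    using assms shoot_zero[of k] shoot_pos[of x k] continuous_on_val
    by (intro IVT'[of "\<lambda>u. X u k"]) simp_all
  then obtain u where u: "0 \<le> u" "X u k = x" by blast
  then have "u \<noteq> 0" using shoot_zero[of k] assms by auto
  with u show thesis by (intro that[of u]) auto
qed

section \<open>The last equation\<close>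

text \<open>The last equation of the system, with right-hand side \<open>T g\<^sub>2(U\<^sub>n)\<close>, determines the initial
  value.\<close>

lemma ex1_initial_value:
  assumes g2: "continuous_on {0<..} g2" "\<And>x. x > 0 \<Longrightarrow> g2 x > 0"
    and T: "T > 0"
    and surj: "(\<lambda>x. g x / g2 x) ` {0<..} = {0<..}"
    and decr: "antimono_on {0<..} (\<lambda>x. g x / g2 x)"
  shows "\<exists>!u. u > 0 \<and> D u m + c / 2 * g (X u (Suc m)) = T * g2 (X u (Suc m))"
proof -
  define q where "q = (\<lambda>x. g x / g2 x)"
  define P where "P = (\<lambda>u. X u (Suc m))"
  define A where "A = (\<lambda>u. (D u m / g (P u) + c / 2) * q (P u))"
  have P_pos: "P u > 0" if "u > 0" for u
    using val_pos[OF that] by (simp only: P_def)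
  have gP_pos: "g (P u) > 0" "g2 (P u) > 0" "q (P u) > 0" if "u > 0" for u
    using P_pos[OF that] pos g2 by (auto simp: q_def)
  have A_eq: "A u = (D u m + c / 2 * g (P u)) / g2 (P u)" if "u > 0" for u
    using gP_pos[OF that] by (simp add: A_def q_def field_simps)
  have last_iff: "D u m + c / 2 * g (P u) = T * g2 (P u) \<longleftrightarrow> A u = T" if "u > 0" for u
    using gP_pos[OF that] by (simp add: A_eq[OF that] field_simps)

  have A_less: "A v < A u" if uv: "0 < u" "u < v" for u v
  proof -
    have v: "0 < v" using uv by simp
    have "P u < P v"
      using shoot_compare[OF uv, of "Suc m"] by (simp only: P_def)
    then have "q (P v) \<le> q (P u)"
      using decr P_pos[OF uv(1)] by (simp add: q_def monotone_on_def)
    moreover have "D v m / g (P v) < D u m / g (P u)"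
      using inc_over_source_less[OF uv] by (simp only: P_def)
    moreover have "0 < D v m / g (P v)"
      using shoot_pos[OF v] gP_pos[OF v] by simp
    ultimately show ?thesis
      unfolding A_def using gP_pos[OF v] c_pos by (intro mult_less_le_imp_less) auto
  qed

  \<comment> \<open>The factor \<open>D/g(P) + c/2\<close> lies between \<open>c/2\<close> and \<open>c (m + 2)\<close>; hence \<open>A \<ge> T\<close> where
    \<open>q(P) = 2 T/c\<close>, and \<open>A \<le> T\<close> where \<open>q(P) = T/(c (m + 2))\<close>.\<close>
  have q_attains: "\<exists>u>0. q (P u) = y" if "y > 0" for y
  proof -
    from surj that obtain x where "x > 0" "q x = y"
      unfolding q_def by (metis (no_types, lifting) greaterThan_iff imageE)
    then show ?thesis
      using val_attains[of x "Suc m"] by (metis P_def)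
  qed
  obtain a where a: "a > 0" "q (P a) = 2 * T / c"
    using q_attains[of "2 * T / c"] T c_pos by auto
  obtain b where b: "b > 0" "q (P b) = T / (c * (real m + 2))"
    using q_attains[of "T / (c * (real m + 2))"] T c_pos by auto
  have "c / 2 * q (P a) \<le> A a"
    unfolding A_def using shoot_pos[OF a(1), of m] gP_pos[OF a(1)]
    by (intro mult_right_mono) auto
  then have Aa: "T \<le> A a"
    using a c_pos by simp
  have "D b m / g (P b) \<le> c * (real m + 1)"
    using inc_le[OF b(1), of m] gP_pos[OF b(1)] by (simp add: divide_le_eq P_def del: val_Suc)
  then have "D b m / g (P b) + c / 2 \<le> c * (real m + 2)"
    using c_pos by (simp add: algebra_simps)
  then have "A b \<le> c * (real m + 2) * q (P b)"
    unfolding A_def using gP_pos[OF b(1)] by (intro mult_right_mono) auto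
  moreover have "c * (real m + 2) \<noteq> 0" using c_pos by simp
  ultimately have Ab: "A b \<le> T"
    using b by simp
  have ab: "a \<le> b"
    using Aa Ab A_less[of b a] b by (cases "a \<le> b") auto

  have contP: "continuous_on {a..b} P"
    unfolding P_def by (rule continuous_on_val)
  have "continuous_on {a..b} (\<lambda>u. (D u m + c / 2 * g (P u)) / g2 (P u))"
  proof (intro continuous_intros)
    show "continuous_on {a..b} (\<lambda>u. D u m)"
      by (rule continuous_on_inc)
    show "continuous_on {a..b} (\<lambda>u. g (P u))"
      by (rule continuous_on_compose2[OF cont contP]) auto
    show "continuous_on {a..b} (\<lambda>u. g2 (P u))"
      by (rule continuous_on_compose2[OF g2(1) contP]) (use a P_pos in auto)
    show "\<forall>u\<in>{a..b}. g2 (P u) \<noteq> 0"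
      using a gP_pos(2) by (metis atLeastAtMost_iff less_le_trans less_irrefl)
  qed
  then have "continuous_on {a..b} A"
    by (rule continuous_on_eq) (use a A_eq in auto)
  then obtain u where "a \<le> u" "A u = T"
    using IVT2'[of A b T a] Aa Ab ab by blast
  then have "u > 0 \<and> A u = T" using a by simp
  moreover have "v = w" if "v > 0 \<and> A v = T" "w > 0 \<and> A w = T" for v w
    using A_less[of v w] A_less[of w v] that by (metis less_irrefl linorder_neqE)
  ultimately have "\<exists>!u. u > 0 \<and> A u = T"
    by blast
  then show ?thesis
    using last_iff unfolding P_def by (metis (no_types, lifting))
qed

end

section \<open>The system as a shooting problem\<close>

lemma solves_system_iff_shoot:
  assumes "n = m + 2" and h: "h = 1 / (real n - 1)"
  shows "solves_system g1 g2 \<alpha> n U \<longleftrightarrow>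
    (\<forall>k\<in>{1..n}. U k = val g1 (h\<^sup>2) (U 1) (k - 1)) \<and>
    inc g1 (h\<^sup>2) (U 1) m + h\<^sup>2 / 2 * g1 (val g1 (h\<^sup>2) (U 1) (Suc m)) =
      h * \<alpha> * g2 (val g1 (h\<^sup>2) (U 1) (Suc m))"
    (is "?sys \<longleftrightarrow> ?traj \<and> ?last")
proof -
  let ?X = "val g1 (h\<^sup>2) (U 1)" and ?D = "inc g1 (h\<^sup>2) (U 1)"
  let ?first = "0 = - (U 2 - U 1) + h\<^sup>2 / 2 * g1 (U 1)"
  let ?mid = "\<forall>k\<in>{2..n-1}. 0 = - (U (k+1) - 2 * U k + U (k-1)) + h\<^sup>2 * g1 (U k)"
  let ?end = "0 = - (U (n-1) - U n) + h\<^sup>2 / 2 * g1 (U n) - h * \<alpha> * g2 (U n)"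
  have sys: "?sys \<longleftrightarrow> ?first \<and> ?mid \<and> ?end"
    by (simp add: solves_system_def Let_def h)
  have fwd: "?traj" if fm: "?first" "?mid"
  proof -
    have "k \<le> m \<Longrightarrow> U (Suc k) = ?X k \<and> U (Suc (Suc k)) = ?X (Suc k)" for k
    proof (induction k)
      case 0
      then show ?case using fm(1) by (simp add: numeral_2_eq_2)
    next
      case (Suc k)
      have "0 = - (U (Suc (Suc (Suc k))) - 2 * U (Suc (Suc k)) + U (Suc k))
          + h\<^sup>2 * g1 (U (Suc (Suc k)))"
        using fm(2)[rule_format, of "Suc (Suc k)"] Suc.prems assms by simp
      then show ?case
        using Suc by (simp add: inc_Suc)
    qed
    note traj = this
    show ?thesis
    proof
      fix k assume k: "k \<in> {1..n}"
      show "U k = ?X (k - 1)"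
      proof (cases "k = n")
        case True
        then show ?thesis using traj[of m] assms by simp
      next
        case False
        then have "k - 1 \<le> m" "Suc (k - 1) = k" using k assms by auto
        then show ?thesis using traj[of "k - 1"] by metis
      qed
    qed
  qed
  have bwd: "?first \<and> ?mid" if traj: "?traj"
  proof
    have "U 2 = ?X 1" using traj[rule_format, of 2] assms by simp
    then show "?first" by simp
    show "?mid"
    proof
      fix k assume k: "k \<in> {2..n-1}"
      then obtain j where j: "k = Suc (Suc j)"
        by (metis atLeastAtMost_iff numeral_2_eq_2 Suc_le_D Suc_le_mono)
      have "U (k - 1) = ?X j" "U k = ?X (Suc j)" "U (k + 1) = ?X (Suc (Suc j))"
        using traj[rule_format, of "k - 1"] traj[rule_format, of k] traj[rule_format, of "k + 1"]
          k j assms by auto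
      then show "0 = - (U (k+1) - 2 * U k + U (k-1)) + h\<^sup>2 * g1 (U k)"
        by (simp add: inc_Suc)
    qed
  qed
  have "?end \<longleftrightarrow> ?last" if traj: "?traj"
  proof -
    have "U n = ?X (Suc m)" "U (n - 1) = ?X m"
      using traj[rule_format, of n] traj[rule_format, of "n - 1"] assms by auto
    then have "U n - U (n - 1) = ?D m" by simp
    with \<open>U n = ?X (Suc m)\<close> show ?thesis by (auto simp del: val_Suc)
  qed
  with sys fwd bwd show ?thesis by blast
qed

theorem theorem6:
  fixes g1 g2 :: "real \<Rightarrow> real" and \<alpha> :: real and n :: nat
  assumes "admissible g1" and "admissible g2"
    and "\<alpha> > 0" and "n \<ge> 2"
    and surj: "(\<lambda>x. g1 x / g2 x) ` {0<..} = {0<..}"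
    and decr: "antimono_on {0<..} (\<lambda>x. g1 x / g2 x)"
  shows "\<exists>!u. u \<in> {1..n} \<rightarrow>\<^sub>E {0<..} \<and> solves_system g1 g2 \<alpha> n u"
proof -
  define h where "h = 1 / (real n - 1)"
  obtain m where m: "n = m + 2"
    using \<open>n \<ge> 2\<close> by (metis le_add_diff_inverse2)
  have h: "h > 0" by (simp add: h_def m)
  interpret g1: convex_source g1 "deriv g1"
    using assms(1) by (rule convex_source_of_admissible)
  interpret g2: convex_source g2 "deriv g2"
    using assms(2) by (rule convex_source_of_admissible)
  interpret shooting g1 "deriv g1" "h\<^sup>2"
    by unfold_locales (use h in simp)
  define last_eq where
    "last_eq u \<longleftrightarrow> D u m + h\<^sup>2 / 2 * g1 (X u (Suc m)) = h * \<alpha> * g2 (X u (Suc m))" for u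
  have sys: "solves_system g1 g2 \<alpha> n U \<longleftrightarrow> (\<forall>k\<in>{1..n}. U k = X (U 1) (k - 1)) \<and> last_eq (U 1)" for U
    unfolding last_eq_def by (rule solves_system_iff_shoot[OF m h_def])
  have "\<exists>!u. u > 0 \<and> last_eq u"
    unfolding last_eq_def
  proof (rule ex1_initial_value[OF _ g2.pos _ surj decr])
    show "continuous_on {0<..} g2"
      using g2.cont by (rule continuous_on_subset) simp
  qed (use h \<open>\<alpha> > 0\<close> in simp_all)
  then obtain u where u: "u > 0" "last_eq u" and uniq: "\<And>v. v > 0 \<Longrightarrow> last_eq v \<Longrightarrow> v = u"
    by blast
  define U where "U = restrict (\<lambda>k. X u (k - 1)) {1..n}"
  have U1: "U 1 = u" by (simp add: U_def m)
  show ?thesis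
  proof
    show "U \<in> {1..n} \<rightarrow>\<^sub>E {0<..} \<and> solves_system g1 g2 \<alpha> n U"
      unfolding sys U1 using u(2) val_pos[OF u(1)] by (auto simp: U_def)
  next
    fix V assume V: "V \<in> {1..n} \<rightarrow>\<^sub>E {0<..} \<and> solves_system g1 g2 \<alpha> n V"
    then have traj: "\<forall>k\<in>{1..n}. V k = X (V 1) (k - 1)" and "last_eq (V 1)"
      unfolding sys by blast+
    moreover have "V 1 > 0" using PiE_mem[of V "{1..n}" "\<lambda>_. {0<..}" 1] V m by simp
    ultimately have "V 1 = u" using uniq by blast
    show "V = U"
    proof (rule PiE_ext)
      show "V \<in> {1..n} \<rightarrow>\<^sub>E {0<..}" using V by blast
      show "U \<in> {1..n} \<rightarrow>\<^sub>E {0<..}"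
        using val_pos[OF u(1)] by (auto simp: U_def)
      show "V k = U k" if "k \<in> {1..n}" for k
        using bspec[OF traj that] that unfolding \<open>V 1 = u\<close> by (simp add: U_def)
    qed
  qed
qed

end
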